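(* Let $a\in(0,1/2)$, let $\lambda_{a,1}\ge\lambda_{a,2}\ge\cdots>0$ be the eigenvalues of the operator $\tilde K_a$ on $L^2(0,1)$ given by $(\tilde K_af)(x)=\sigma_a\int_0^1|x-u|^{-a}f(u)\,du$ with $\sigma_a=\sqrt{(1-2a)(1-a)/2}$, and let $V=\sum_{n=1}^\infty\lambda_{a,n}(\varepsilon_n^2-1)$ with $\varepsilon_n$ i.i.d. standard normal, so that $V$ has the Rosenblatt distribution with parameter $a$. Let $\phi(z)=\mathbb{E}(e^{izV})$, $z\in\mathbb{R}$, be its characteristic function and $\phi_{LT}(s)=\mathbb{E}(e^{-sV})$ its Laplace transform. Then $\phi(z)=\phi_{LT}(-iz)$ for all $z\in\mathbb{R}$, and for every real $s>-\frac{1}{2\lambda_{a,1}}$ the Laplace transform $\phi_{LT}(s)$ admits each of the following representations: (i) $$\ln(\phi_{LT}(s))=\sum_{n=1}^\infty\left(\frac{(\lambda_{a,n}s)^2}{1+\lambda_{a,n}s}-\sum_{k=2}^\infty\frac{1}{2k-1}\left(\frac{\lambda_{a,n}s}{1+\lambda_{a,n}s}\right)^{2k-1}\right);$$ (ii) $$\ln(\phi_{LT}(s))=\sum_{n=1}^\infty\lambda_{a,n}s\,\ln(1+2\lambda_{a,n}s)\sum_{k=1}^\infty\frac{1}{2^k\left(1+(1+2\lambda_{a,n}s)^{2^{-k}}\right)};$$ (iii) $$\ln(\phi_{LT}(s))=\frac12\sum_{n=1}^\infty\sum_{k=1}^\infty2^{k-1}\left((1+2\lambda_{a,n}s)^{2^{-k}}-1\right)^2;$$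 (iv) $$\ln(\phi_{LT}(s))=\int_0^s\sum_{n=1}^\infty\frac{2\lambda_{a,n}^2u}{2\lambda_{a,n}u+1}\,du.$$
   Context: For $a\in(0,1/2)$, the Riesz integral operator $\tilde K_a:L^2(0,1)\to L^2(0,1)$, $(\tilde K_af)(x)=\sigma_a\int_0^1|x-u|^{-a}f(u)\,du$ with $\sigma_a=\sqrt{(1-2a)(1-a)/2}$, is a positive, self-adjoint, Hilbert–Schmidt operator. Its eigenvalues $\lambda_{a,1}\ge\lambda_{a,2}\ge\cdots>0$ are listed in non-increasing order with multiplicity; they satisfy $\sum_{n=1}^\infty\lambda_{a,n}=\infty$ and $\sum_{n=1}^\infty\lambda_{a,n}^2=1/2$. The Rosenblatt distribution with shape parameter $a$ is the law of $V=\sum_{n=1}^\infty\lambda_{a,n}(\varepsilon_n^2-1)$, where $\varepsilon_1,\varepsilon_2,\ldots$ are i.i.d. standard normal random variables and the series converges in $L^2$; it has zero mean and unit variance. The expression $\phi_{LT}(s)=\mathbb{E}(e^{-sV})$ is understood for complex $s$ with $\mathrm{Re}\,s>-\frac{1}{2\lambda_{a,1}}$, so that $\phi_{LT}(-iz)$ makes sense for $z\in\mathbb{R}$. The notation $x^{2^{-k}}$ means $x^{(2^{-k})}$, the positive $2^k$-th root of $x>0$. For $s<0$ the integral $\int_0^s$ is the oriented integral $-\int_s^0$. *)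

theory Defs
  imports "HOL-Probability.Probability"
begin

text \<open>
  The members of \<open>L2 M\<close> are functions, not equivalence classes; all notions below identify
  functions that agree almost everywhere.
\<close>

definition L2 :: "'a measure \<Rightarrow> ('a \<Rightarrow> real) set" where
  "L2 M = {f \<in> borel_measurable M. integrable M (\<lambda>x. (f x)\<^sup>2)}"

definition L2_sums :: "'a measure \<Rightarrow> (nat \<Rightarrow> 'a \<Rightarrow> real) \<Rightarrow> ('a \<Rightarrow> real) \<Rightarrow> bool" where
  "L2_sums M X V \<longleftrightarrow> (\<forall>n. X n \<in> L2 M) \<and> V \<in> L2 M \<and>
     (\<lambda>N. LINT x|M. ((\<Sum>n<N. X n x) - V x)\<^sup>2) \<longlonglongrightarrow> 0"

text \<open>
  \<open>ae_dim M W d\<close>: modulo almost everywhere equality, the linear space \<open>W\<close> of functions has a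
  basis with \<open>d\<close> elements.
\<close>

definition ae_dim :: "'a measure \<Rightarrow> ('a \<Rightarrow> real) set \<Rightarrow> nat \<Rightarrow> bool" where
  "ae_dim M W d \<longleftrightarrow> (\<exists>e :: nat \<Rightarrow> 'a \<Rightarrow> real.
     (\<forall>i<d. e i \<in> W) \<and>
     (\<forall>c :: nat \<Rightarrow> real. (AE x in M. (\<Sum>i<d. c i * e i x) = 0) \<longrightarrow> (\<forall>i<d. c i = 0)) \<and>
     (\<forall>f\<in>W. \<exists>c :: nat \<Rightarrow> real. AE x in M. f x = (\<Sum>i<d. c i * e i x)))"

definition unit_lborel :: "real measure" where
  "unit_lborel = restrict_space lborel {0<..<1}"

definition riesz_sigma :: "real \<Rightarrow> real" where
  "riesz_sigma a = sqrt ((1 - 2 * a) * (1 - a) / 2)"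

definition riesz_op :: "real \<Rightarrow> (real \<Rightarrow> real) \<Rightarrow> real \<Rightarrow> real" where
  "riesz_op a f x = riesz_sigma a * (LINT u|unit_lborel. \<bar>x - u\<bar> powr (- a) * f u)"

definition riesz_eigenspace :: "real \<Rightarrow> real \<Rightarrow> (real \<Rightarrow> real) set" where
  "riesz_eigenspace a \<mu> =
     {f \<in> L2 unit_lborel. AE x in unit_lborel. riesz_op a f x = \<mu> * f x}"

text \<open>
  The sequence \<open>lam\<close> lists all eigenvalues in non-increasing order, each one as often as
  the dimension of its eigenspace; numbers that are not eigenvalues have an eigenspace of
  dimension 0 and do not occur. Indices start at 0: \<open>lam 0\<close> is the largest one.
\<close>

definition riesz_eigenvalues :: "real \<Rightarrow> (nat \<Rightarrow> real) \<Rightarrow> bool" where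
  "riesz_eigenvalues a lam \<longleftrightarrow> decseq lam \<and> (\<forall>n. lam n > 0) \<and>
     (\<forall>\<mu>. finite {n. lam n = \<mu>} \<and>
          ae_dim unit_lborel (riesz_eigenspace a \<mu>) (card {n. lam n = \<mu>}))"

definition laplace_transform :: "'a measure \<Rightarrow> ('a \<Rightarrow> real) \<Rightarrow> complex \<Rightarrow> complex" where
  "laplace_transform M V s = (CLINT w|M. exp (- s * complex_of_real (V w)))"

end

theory Submission
  imports Defs
begin

text \<open>
  Each summand satisfies \<open>E exp (- s * l * (\<epsilon>\<^sup>2 - 1)) = exp (l s - ln (1 + 2 l s) / 2)\<close>, so by
  independence \<open>ln (E exp (- s * V))\<close> is, formally, the sum of \<open>log_mgf (lam n * s)\<close> with
  \<open>log_mgf x = x - ln (1 + 2 x) / 2\<close>. The four representations are four expansions of \<open>log_mgf\<close>: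
  the artanh series of the logarithm, two telescoping series built on
  \<open>2 ^ k * (t powr (1 / 2 ^ k) - 1) \<longlonglongrightarrow> ln t\<close> with \<open>t = 1 + 2 x\<close>, and termwise
  integration of the derivative. The squares \<open>(lam n)\<^sup>2\<close> are
  summable because the partial sums have bounded second moments. The passage to the
  limit under the expectation works because \<open>s\<close> may be replaced by \<open>p * s\<close> for some \<open>p > 1\<close>
  without leaving the domain, so the exponentials of the partial sums are bounded in \<open>L\<^sup>p\<close> and
  hence uniformly integrable.
\<close>

subsection \<open>Series for the cumulant function of a centred chi-square variable\<close>

definition log_mgf :: "real \<Rightarrow> real" where
  "log_mgf x = x - ln (1 + 2 * x) / 2"

lemma log_mgf_nonneg:
  assumes "- (1 / 2) < x"
  shows "0 \<le> log_mgf x"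
  using ln_add_one_self_le_self2[of "2 * x"] assms by (simp add: log_mgf_def)

text \<open>From \<open>ln t \<ge> 1 - 1 / t\<close>. The bound is quadratic near 0, which lets
  square summability of the eigenvalues control the sum of
  \<open>log_mgf (lam n * s)\<close>.\<close>

lemma log_mgf_le:
  assumes "- (1 / 2) < x"
  shows "log_mgf x \<le> 2 * x\<^sup>2 / (1 + 2 * x)"
proof -
  have "ln 1 - ln (1 + 2 * x) \<le> (1 - (1 + 2 * x)) / (1 + 2 * x)"
    using assms by (intro ln_diff_le) auto
  then have "log_mgf x \<le> x - x / (1 + 2 * x)"
    by (simp add: log_mgf_def mult.commute)
  also have "\<dots> = 2 * x\<^sup>2 / (1 + 2 * x)"
    using assms by (simp add: field_simps power2_eq_square)
  finally show ?thesis .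
qed

text \<open>Here \<open>ln t\<close> is twice the artanh of \<open>(t - 1) / (t + 1)\<close>, and
  for \<open>t = 1 + 2 * x\<close> this argument is \<open>x / (1 + x)\<close>. Removing the linear
  term of the series leaves \<open>x - x / (1 + x)\<close>, which is
  \<open>x\<^sup>2 / (1 + x)\<close>.\<close>

lemma log_mgf_artanh_series:
  fixes x :: real
  assumes "- (1 / 2) < x"
  shows "(\<lambda>k. 1 / (2 * real (k + 2) - 1) * (x / (1 + x)) ^ (2 * (k + 2) - 1))
           sums (x\<^sup>2 / (1 + x) - log_mgf x)"
proof -
  have y: "(1 + 2 * x - 1) / (1 + 2 * x + 1) = x / (1 + x)"
    using assms by (simp add: field_simps)
  have "(\<lambda>n. 2 * (x / (1 + x)) ^ (2 * n + 1) / of_nat (2 * n + 1)) sums ln (1 + 2 * x)"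
    using ln_series_quadratic[of "1 + 2 * x"] assms unfolding y by simp
  then have "(\<lambda>n. 1 / 2 * (2 * (x / (1 + x)) ^ (2 * n + 1) / of_nat (2 * n + 1)))
      sums (1 / 2 * ln (1 + 2 * x))"
    by (rule sums_mult)
  then have "(\<lambda>n. (x / (1 + x)) ^ (2 * n + 1) / of_nat (2 * n + 1)) sums (ln (1 + 2 * x) / 2)"
    by simp
  \<comment> \<open>The dropped term is \<open>x / (1 + x)\<close>. Index \<open>k\<close> now
    carries the odd exponent \<open>2 * k + 3\<close>, that is \<open>2 * (k + 2) - 1\<close>, so a
    sum from 2 is written with \<open>k + 2\<close>.\<close>
  from sums_split_initial_segment[OF this, of 1]
  have "(\<lambda>k. (x / (1 + x)) ^ (2 * (k + 1) + 1) / of_nat (2 * (k + 1) + 1))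
      sums (ln (1 + 2 * x) / 2 - x / (1 + x))"
    by simp
  moreover have "ln (1 + 2 * x) / 2 - x / (1 + x) = x\<^sup>2 / (1 + x) - log_mgf x"
    using assms by (simp add: log_mgf_def field_simps power2_eq_square)
  moreover have "(x / (1 + x)) ^ (2 * (k + 1) + 1) / of_nat (2 * (k + 1) + 1) =
      1 / (2 * real (k + 2) - 1) * (x / (1 + x)) ^ (2 * (k + 2) - 1)" for k
    by (simp add: algebra_simps)
  ultimately show ?thesis
    by (simp only:)
qed

section \<open>Dyadic roots and telescoping series for the logarithm\<close>

lemma powr_half_power_Suc:
  fixes t :: real
  assumes "0 < t"
  shows "t powr (1 / 2 ^ k) = (t powr (1 / 2 ^ Suc k))\<^sup>2"
  using assms by (simp add: powr_powr flip: powr_numeral)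

text \<open>These are the difference quotients of \<open>h \<mapsto> t powr h\<close> at 0 along
  \<open>h = 1 / 2 ^ k\<close>.\<close>

lemma powr_half_power_tendsto_ln:
  fixes t :: real
  assumes "0 < t"
  shows "(\<lambda>k. 2 ^ k * (t powr (1 / 2 ^ k) - 1)) \<longlonglongrightarrow> ln t"
proof -
  have "((\<lambda>h. t powr h) has_real_derivative ln t) (at 0)"
    using assms by (auto intro!: derivative_eq_intros)
  then have "((\<lambda>h. (t powr h - 1) / h) \<longlongrightarrow> ln t) (at 0)"
    using assms by (simp add: DERIV_def)
  moreover have "filterlim (\<lambda>k::nat. 1 / 2 ^ k) (at (0::real)) sequentially"
    using LIMSEQ_divide_realpow_zero[of 2 1]
    by (auto simp: filterlim_at)
  ultimately have "(\<lambda>k. (t powr (1 / 2 ^ k) - 1) / (1 / 2 ^ k)) \<longlonglongrightarrow> ln t"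
    by (rule filterlim_compose)
  then show ?thesis
    by (simp add: mult.commute)
qed

text \<open>With \<open>r\<close> the root at level \<open>Suc k\<close>,
  \<open>2 ^ k * (r - 1)\<^sup>2\<close> equals
  \<open>2 ^ k * (r\<^sup>2 - 1) - 2 ^ Suc k * (r - 1)\<close>, and \<open>r\<^sup>2\<close> is the
  root at level \<open>k\<close>. The series telescopes from \<open>t - 1\<close> down to
  \<open>ln t\<close>.\<close>

lemma log_mgf_square_series:
  assumes "- (1 / 2) < x"
  shows "(\<lambda>k. 2 ^ k * ((1 + 2 * x) powr (1 / 2 ^ Suc k) - 1)\<^sup>2) sums (2 * log_mgf x)"
proof -
  define t where "t = 1 + 2 * x"
  have t: "0 < t"
    using assms by (simp add: t_def)
  have "2 ^ k * (t powr (1 / 2 ^ Suc k) - 1)\<^sup>2 =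
      2 ^ k * (t powr (1 / 2 ^ k) - 1) - 2 ^ Suc k * (t powr (1 / 2 ^ Suc k) - 1)" for k
    unfolding powr_half_power_Suc[OF t, of k]
    by (simp add: power2_eq_square algebra_simps)
  with telescope_sums'[OF powr_half_power_tendsto_ln[OF t]]
  have "(\<lambda>k. 2 ^ k * (t powr (1 / 2 ^ Suc k) - 1)\<^sup>2) sums (t - 1 - ln t)"
    using t by simp
  then show ?thesis
    by (simp add: t_def log_mgf_def)
qed

text \<open>The reciprocals of the quotients tending to \<open>ln t\<close> telescope;
  \<open>t \<noteq> 1\<close> keeps them and their limit finite.\<close>

lemma inverse_ln_series:
  fixes t :: real
  assumes "0 < t" and "t \<noteq> 1"
  shows "(\<lambda>k. 1 / (2 ^ Suc k * (1 + t powr (1 / 2 ^ Suc k)))) sums (1 / ln t - 1 / (t - 1))"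
proof -
  have ne: "t powr (1 / 2 ^ k) \<noteq> 1" for k
    using assms by (simp add: powr_def)
  have "1 / (2 ^ Suc k * (1 + t powr (1 / 2 ^ Suc k))) =
      1 / (2 ^ Suc k * (t powr (1 / 2 ^ Suc k) - 1)) - 1 / (2 ^ k * (t powr (1 / 2 ^ k) - 1))" for k
  proof -
    define r where "r = t powr (1 / 2 ^ Suc k)"
    have r: "0 < r" "r \<noteq> 1" and r2: "t powr (1 / 2 ^ k) = r\<^sup>2"
      using assms ne[of "Suc k"] powr_half_power_Suc[of t k] by (simp_all add: r_def)
    \<comment> \<open>Partial fractions for \<open>p = r - 1\<close> and \<open>q = 1 + r\<close>:
      their gap 2 cancels one factor of \<open>2 ^ Suc k\<close>.\<close>
    have *: "1 / (2 * P * q) = 1 / (2 * P * p) - 1 / (P * (p * q))"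
      if "P \<noteq> 0" "p \<noteq> 0" "q \<noteq> 0" "q - p = 2" for p q P :: real
    proof -
      have "1 / (2 * P * q) = 1 / (2 * P * p) - (q - p) / (2 * P * (p * q))"
        using that(1-3) by (simp add: field_simps)
      then show ?thesis
        unfolding that(4) by simp
    qed
    have "r\<^sup>2 - 1 = (r - 1) * (1 + r)"
      by (simp add: power2_eq_square algebra_simps)
    then show ?thesis
      using *[of "2 ^ k" "r - 1" "1 + r"] r unfolding r2 r_def[symmetric] by simp
  qed
  moreover have "(\<lambda>k. 1 / (2 ^ k * (t powr (1 / 2 ^ k) - 1))) \<longlonglongrightarrow> 1 / ln t"
    using assms by (intro tendsto_divide tendsto_const powr_half_power_tendsto_ln) auto
  from telescope_sums[OF this]
  have "(\<lambda>k. 1 / (2 ^ Suc k * (t powr (1 / 2 ^ Suc k) - 1)) - 1 / (2 ^ k * (t powr (1 / 2 ^ k) - 1)))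
      sums (1 / ln t - 1 / (t - 1))"
    using assms by simp
  ultimately show ?thesis
    by simp
qed

lemma summable_inverse_ln_series:
  fixes t :: real
  assumes "0 < t"
  shows "summable (\<lambda>k. 1 / (2 ^ Suc k * (1 + t powr (1 / 2 ^ Suc k))))"
proof (cases "t = 1")
  case True
  \<comment> \<open>At \<open>t = 1\<close>, which is the case \<open>s = 0\<close>, telescoping
    breaks down, but every root is 1 and the series is geometric.\<close>
  have "summable (\<lambda>k. (1 / 4) * (1 / 2 :: real) ^ k)"
    by (intro summable_mult summable_geometric) simp
  then show ?thesis
    using True by (simp add: power_one_over field_simps)
next
  case False
  then show ?thesis
    using inverse_ln_series[OF assms] by (simp add: sums_iff)
qed

text \<open>The prefactor clears both denominators of \<open>1 / ln t - 1 / (2 * x)\<close>. At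
  \<open>x = 0\<close> it vanishes, whatever the series is.\<close>

lemma log_mgf_inverse_ln_series:
  assumes "- (1 / 2) < x"
  shows "x * ln (1 + 2 * x) * (\<Sum>k. 1 / (2 ^ Suc k * (1 + (1 + 2 * x) powr (1 / 2 ^ Suc k))))
           = log_mgf x"
proof (cases "x = 0")
  case True
  then show ?thesis
    by (simp add: log_mgf_def)
next
  case False
  then have *: "(\<Sum>k. 1 / (2 ^ Suc k * (1 + (1 + 2 * x) powr (1 / 2 ^ Suc k)))) =
      1 / ln (1 + 2 * x) - 1 / (2 * x)" and "ln (1 + 2 * x) \<noteq> 0"
    using inverse_ln_series[of "1 + 2 * x"] assms by (simp_all add: sums_iff)
  then show ?thesis
    using False unfolding * by (simp add: log_mgf_def field_simps)
qed

section \<open>Summation over the eigenvalues and termwise integration\<close>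

lemma DERIV_log_mgf_scaled:
  assumes "0 < 1 + 2 * l * u"
  shows "((\<lambda>u. log_mgf (l * u)) has_real_derivative 2 * l\<^sup>2 * u / (2 * l * u + 1)) (at u within S)"
proof -
  have "1 + 2 * (l * u) \<noteq> 0"
    using assms by (simp add: mult.assoc)
  then show ?thesis
    unfolding log_mgf_def using assms
    by (auto intro!: derivative_eq_intros simp: field_simps power2_eq_square)
qed

text \<open>A lower bound uniform in \<open>n\<close> and \<open>u\<close> for the arguments of the
  logarithm. For \<open>u \<ge> 0\<close> they are at least 1; for negative \<open>u\<close> the
  worst case is the largest eigenvalue at the endpoint \<open>s\<close>.\<close>

lemma decseq_scaled_ge:
  fixes lam :: "nat \<Rightarrow> real"
  assumes "decseq lam" and "\<And>n. 0 < lam n" and "min 0 s \<le> u"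
  shows "min 1 (1 + 2 * lam 0 * s) \<le> 1 + 2 * lam n * u"
proof (cases "0 \<le> u")
  case True
  then show ?thesis
    using assms(2)[of n] by (simp add: min_le_iff_disj)
next
  case False
  then have "s \<le> u" "s < 0"
    using assms(3) by (auto simp: min_def split: if_splits)
  have "lam n \<le> lam 0"
    using assms(1) by (simp add: decseq_def)
  then have "lam 0 * s \<le> lam n * s"
    using \<open>s < 0\<close> by (simp add: mult_right_mono_neg)
  also have "\<dots> \<le> lam n * u"
    using \<open>s \<le> u\<close> assms(2)[of n] by simp
  finally show ?thesis
    by (simp add: min_le_iff_disj mult.assoc)
qed

context
  fixes lam :: "nat \<Rightarrow> real" and s :: real
  assumes dec: "decseq lam" and pos: "\<And>n. 0 < lam n" and sq: "summable (\<lambda>n. (lam n)\<^sup>2)"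
    and dom: "- 1 / (2 * lam 0) < s"
begin

lemma domain_margin: "0 < min 1 (1 + 2 * lam 0 * s)"
  using dom pos[of 0] by (simp add: field_simps)

lemma scaled_gt: "- (1 / 2) < lam n * s"
  using decseq_scaled_ge[OF dec pos, of s s n] domain_margin by simp

lemma summable_log_mgf: "summable (\<lambda>n. log_mgf (lam n * s))"
proof (rule summable_comparison_test'[where N = 0])
  define m where "m = min 1 (1 + 2 * lam 0 * s)"
  show "summable (\<lambda>n. (2 * s\<^sup>2 / m) * (lam n)\<^sup>2)"
    by (intro summable_mult sq)
  fix n
  have m: "0 < m" "m \<le> 1 + 2 * lam n * s"
    using domain_margin decseq_scaled_ge[OF dec pos, of s s n] by (simp_all add: m_def)
  have "log_mgf (lam n * s) \<le> 2 * (lam n * s)\<^sup>2 / (1 + 2 * (lam n * s))"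
    by (rule log_mgf_le[OF scaled_gt])
  also have "\<dots> \<le> 2 * (lam n * s)\<^sup>2 / m"
    using m by (intro divide_left_mono) (auto simp: mult.assoc)
  finally show "norm (log_mgf (lam n * s)) \<le> (2 * s\<^sup>2 / m) * (lam n)\<^sup>2"
    using log_mgf_nonneg[OF scaled_gt[of n]] by (simp add: power_mult_distrib mult_ac)
qed

text \<open>The integrand is the termwise derivative of the series of
  \<open>log_mgf (lam n * u)\<close>. A bound by a multiple of \<open>(lam n)\<^sup>2\<close> gives
  uniform convergence by the Weierstrass test, hence a continuous integrand and an
  antiderivative.\<close>

lemma log_mgf_integral_representation:
  defines "f \<equiv> \<lambda>u. \<Sum>n. 2 * (lam n)\<^sup>2 * u / (2 * lam n * u + 1)"
  shows "summable (\<lambda>n. 2 * (lam n)\<^sup>2 * s / (2 * lam n * s + 1))"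
    and "interval_lebesgue_integrable lborel (ereal 0) (ereal s) f"
    and "(LBINT u=ereal 0..ereal s. f u) = (\<Sum>n. log_mgf (lam n * s))"
proof -
  define m where "m = min 1 (1 + 2 * lam 0 * s)"
  \<comment> \<open>The segment between 0 and \<open>s\<close>, for either sign of
    \<open>s\<close>.\<close>
  define S where "S = {min 0 s..max 0 s}"
  define d where "d = (\<lambda>n u. 2 * (lam n)\<^sup>2 * u / (2 * lam n * u + 1))"
  have "0 < m"
    using domain_margin by (simp add: m_def)
  have m: "m \<le> 1 + 2 * lam n * u" if "u \<in> S" for n u
    using decseq_scaled_ge[OF dec pos, of s u n] that by (simp add: m_def S_def)
  have bound: "norm (d n u) \<le> (2 * \<bar>s\<bar> / m) * (lam n)\<^sup>2" if "u \<in> S" for n u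
  proof -
    have "norm (d n u) = 2 * (lam n)\<^sup>2 * \<bar>u\<bar> / (1 + 2 * lam n * u)"
      using m[OF that, of n] \<open>0 < m\<close> by (simp add: d_def abs_mult add.commute)
    also have "\<dots> \<le> 2 * (lam n)\<^sup>2 * \<bar>s\<bar> / m"
      using m[OF that, of n] \<open>0 < m\<close> that
      by (intro frac_le mult_left_mono) (auto simp: S_def)
    finally show ?thesis
      by (simp add: mult_ac)
  qed
  have sum_bound: "summable (\<lambda>n. (2 * \<bar>s\<bar> / m) * (lam n)\<^sup>2)"
    by (intro summable_mult sq)
  have s: "s \<in> S" "0 \<in> S"
    by (simp_all add: S_def)
  have "summable (\<lambda>n. d n s)"
    using sum_bound bound[OF s(1)] by (rule summable_comparison_test'[where N = 0])
  then show "summable (\<lambda>n. 2 * (lam n)\<^sup>2 * s / (2 * lam n * s + 1))"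
    by (simp add: d_def)
  have ul: "uniform_limit S (\<lambda>n u. \<Sum>i<n. d i u) f sequentially"
    using Weierstrass_m_test[OF bound sum_bound] by (simp add: f_def d_def)
  have cont: "continuous_on S f"
  proof (rule uniform_limit_theorem[OF _ ul])
    have "continuous_on S (d i)" for i
    proof -
      have "2 * lam i * u + 1 \<noteq> 0" if "u \<in> S" for u
        using m[OF that, of i] \<open>0 < m\<close> by simp
      then show ?thesis
        unfolding d_def by (intro continuous_intros) auto
    qed
    then show "\<forall>\<^sub>F n in sequentially. continuous_on S (\<lambda>u. \<Sum>i<n. d i u)"
      by (intro always_eventually allI continuous_on_sum) auto
  qed simp
  \<comment> \<open>Differentiating the series termwise also needs its convergence at one point: at
    0 every term vanishes.\<close>
  have "\<exists>g. \<forall>u\<in>S. (\<lambda>n. log_mgf (lam n * u)) sums g u \<and> (g has_field_derivative f u) (at u within S)"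
  proof (rule has_field_derivative_series[OF _ _ ul s(2)])
    show "((\<lambda>u. log_mgf (lam n * u)) has_real_derivative d n u) (at u within S)" if "u \<in> S" for n u
      unfolding d_def using m[OF that, of n] \<open>0 < m\<close> by (intro DERIV_log_mgf_scaled) simp
  qed (simp_all add: S_def log_mgf_def)
  then obtain g where g: "\<And>u. u \<in> S \<Longrightarrow> (\<lambda>n. log_mgf (lam n * u)) sums g u"
      "\<And>u. u \<in> S \<Longrightarrow> (g has_field_derivative f u) (at u within S)"
    by blast
  have "(LBINT u=ereal 0..ereal s. f u) = g s - g 0"
    using cont g(2) unfolding S_def has_real_derivative_iff_has_vector_derivative
    by (intro interval_integral_FTC_finite) simp_all
  moreover have "g 0 = 0" "g s = (\<Sum>n. log_mgf (lam n * s))"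
    using g(1)[OF s(2)] g(1)[OF s(1)] by (simp_all add: log_mgf_def sums_iff)
  ultimately show "(LBINT u=ereal 0..ereal s. f u) = (\<Sum>n. log_mgf (lam n * s))"
    by simp
  show "interval_lebesgue_integrable lborel (ereal 0) (ereal s) f"
  proof (cases "0 \<le> s")
    case True
    then show ?thesis
      using cont interval_integrable_continuous_on[of 0 s f] by (simp add: S_def)
  next
    case False
    \<comment> \<open>The continuity criterion wants ordered endpoints, so the oriented interval is
      reversed.\<close>
    then have "interval_lebesgue_integrable lborel (ereal s) (ereal 0) f"
      using cont interval_integrable_continuous_on[of s 0 f] by (simp add: S_def)
    then show ?thesis
      by (subst interval_integrable_endpoints_reverse)
  qed
qed

end

subsection \<open>Convergence of expectations and Gaussian integrals\<close>

text \<open>A Vitali-type convergence theorem: a uniform bound on moments of order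
  \<open>p > 1\<close> replaces a common dominating function.\<close>

lemma (in prob_space) tendsto_expectation_bounded_powr:
  fixes Y :: "nat \<Rightarrow> 'a \<Rightarrow> real"
  assumes [measurable]: "\<And>i. Y i \<in> borel_measurable M" "Z \<in> borel_measurable M"
    and nonneg: "\<And>i x. 0 \<le> Y i x" "\<And>x. 0 \<le> Z x"
    and lim: "AE x in M. (\<lambda>i. Y i x) \<longlonglongrightarrow> Z x"
    and p: "1 < p"
    and int: "\<And>i. integrable M (\<lambda>x. Y i x powr p)"
    and bound: "\<And>i. expectation (\<lambda>x. Y i x powr p) \<le> C"
  shows "integrable M Z" and "(\<lambda>i. expectation (Y i)) \<longlonglongrightarrow> expectation Z"
proof -
  \<comment> \<open>The part of \<open>Y i\<close> above height \<open>K\<close> has expectation at most \<open>C * K powr (1 - p)\<close>,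
    uniformly in \<open>i\<close>; the truncations at \<open>K\<close> converge by dominated convergence.\<close>
  have tail: "y \<le> min y K + K powr (1 - p) * y powr p" if "0 \<le> y" "0 < K" for y K :: real
  proof (cases "y \<le> K")
    case False
    then have "1 \<le> (y / K) powr (p - 1)"
      using p that by (intro ge_one_powr_ge_zero) auto
    then have "y * 1 \<le> y * (y / K) powr (p - 1)"
      using that by (intro mult_left_mono) auto
    also have "\<dots> = K powr (1 - p) * y powr p"
      using that False by (simp add: powr_divide powr_diff field_simps)
    finally show ?thesis
      using that False by simp
  qed simp
  have le1: "y \<le> 1 + y powr p" if "0 \<le> y" for y :: real
    using tail[OF that, of 1] by (simp add: min_def add_increasing2 split: if_splits)
  have intY: "integrable M (Y i)" for i
  proof (rule Bochner_Integration.integrable_bound)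
    show "integrable M (\<lambda>x. 1 + Y i x powr p)"
      using int by simp
    show "AE x in M. norm (Y i x) \<le> norm (1 + Y i x powr p)"
      using le1 nonneg(1)[of i] by (intro AE_I2) simp
  qed simp
  have EY: "expectation (Y i) \<le> 1 + C" for i
  proof -
    have "expectation (Y i) \<le> expectation (\<lambda>x. 1 + Y i x powr p)"
      using le1 nonneg(1)[of i] int intY by (intro integral_mono) auto
    also have "\<dots> \<le> 1 + C"
      using int bound[of i] by (simp add: prob_space)
    finally show ?thesis .
  qed
  \<comment> \<open>Fatou's lemma, with the uniform bound \<open>1 + C\<close> on the first
    moments.\<close>
  show intZ: "integrable M Z"
  proof (rule integrableI_nonneg)
    have "(\<integral>\<^sup>+ x. ennreal (Z x) \<partial>M) = (\<integral>\<^sup>+ x. liminf (\<lambda>i. ennreal (Y i x)) \<partial>M)"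
      using lim
      by (intro nn_integral_cong_AE, eventually_elim)
        (intro lim_imp_Liminf[symmetric] tendsto_ennrealI, auto)
    also have "\<dots> \<le> liminf (\<lambda>i. \<integral>\<^sup>+ x. ennreal (Y i x) \<partial>M)"
      by (intro nn_integral_liminf) simp
    also have "\<dots> \<le> liminf (\<lambda>i. ennreal (1 + C))"
      using intY EY nonneg by (intro Liminf_mono always_eventually)
        (simp add: nn_integral_eq_integral ennreal_leI)
    also have "\<dots> < \<infinity>"
      by (simp add: Liminf_const)
    finally show "(\<integral>\<^sup>+ x. ennreal (Z x) \<partial>M) < \<infinity>" .
  qed (use nonneg in auto)
  have truncK: "(\<lambda>i. expectation (\<lambda>x. min (Y i x) K)) \<longlonglongrightarrow> expectation (\<lambda>x. min (Z x) K)"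
    if "0 < K" for K
  proof (rule integral_dominated_convergence[where w = "\<lambda>_. K"])
    show "AE x in M. (\<lambda>i. min (Y i x) K) \<longlonglongrightarrow> min (Z x) K"
      using lim by eventually_elim (intro tendsto_intros)
  qed (use nonneg that in auto)
  have "(\<lambda>k. expectation (\<lambda>x. min (Z x) (real k))) \<longlonglongrightarrow> expectation Z"
  proof (rule integral_dominated_convergence[where w = Z])
    show "AE x in M. (\<lambda>k. min (Z x) (real k)) \<longlonglongrightarrow> Z x"
    proof (intro AE_I2 tendsto_eventually)
      fix x
      show "\<forall>\<^sub>F k in sequentially. min (Z x) (real k) = Z x"
        using eventually_ge_at_top[of "nat \<lceil>Z x\<rceil>"] by eventually_elim (simp add: min_def nat_le_iff ceiling_le_iff)
    qed
  qed (use nonneg intZ in auto)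
  moreover have "(\<lambda>k. C * real k powr (1 - p)) \<longlonglongrightarrow> 0"
    using p by (intro tendsto_mult_right_zero tendsto_neg_powr filterlim_real_sequentially) simp
  ultimately have ZK: "(\<lambda>k. expectation Z - expectation (\<lambda>x. min (Z x) (real k)) + C * real k powr (1 - p))
      \<longlonglongrightarrow> expectation Z - expectation Z + 0"
    by (intro tendsto_intros)
  have EYK: "\<bar>expectation (Y i) - expectation (\<lambda>x. min (Y i x) K)\<bar> \<le> C * K powr (1 - p)"
    if "0 < K" for i K
  proof -
    have intmin: "integrable M (\<lambda>x. min (Y i x) K)"
      using intY[of i] by (rule Bochner_Integration.integrable_bound) (use nonneg that in auto)
    have "expectation (Y i) \<le> expectation (\<lambda>x. min (Y i x) K + K powr (1 - p) * Y i x powr p)"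
      using intY int intmin tail that nonneg by (intro integral_mono) auto
    also have "\<dots> = expectation (\<lambda>x. min (Y i x) K) + K powr (1 - p) * expectation (\<lambda>x. Y i x powr p)"
      using int intmin by simp
    also have "\<dots> \<le> expectation (\<lambda>x. min (Y i x) K) + K powr (1 - p) * C"
      using bound by (intro add_left_mono mult_left_mono) auto
    finally have "expectation (Y i) - expectation (\<lambda>x. min (Y i x) K) \<le> C * K powr (1 - p)"
      by (simp add: mult.commute)
    moreover have "expectation (\<lambda>x. min (Y i x) K) \<le> expectation (Y i)"
      using intY intmin by (intro integral_mono) auto
    ultimately show ?thesis
      by simp
  qed
  show "(\<lambda>i. expectation (Y i)) \<longlonglongrightarrow> expectation Z"
  proof (rule LIMSEQ_I)
    fix e :: real
    assume "0 < e"
    \<comment> \<open>The height \<open>k\<close> is fixed first, so that both truncation errors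
      together stay below \<open>e / 2\<close> for all \<open>i\<close>. Only then does
      \<open>i\<close> grow, making the truncated expectations \<open>e / 2\<close>-close.\<close>
    have "\<forall>\<^sub>F k in sequentially. 0 < k \<and>
        expectation Z - expectation (\<lambda>x. min (Z x) (real k)) + C * real k powr (1 - p) < e / 2"
      using order_tendstoD(2)[OF ZK, of "e / 2"] \<open>0 < e\<close> eventually_gt_at_top[of 0]
      by (auto intro: eventually_conj)
    then obtain k where k: "0 < k"
        "expectation Z - expectation (\<lambda>x. min (Z x) (real k)) + C * real k powr (1 - p) < e / 2"
      by (auto simp: eventually_sequentially)
    have intminZ: "integrable M (\<lambda>x. min (Z x) (real k))"
      using intZ by (rule Bochner_Integration.integrable_bound) (use nonneg in auto)
    have "expectation (\<lambda>x. min (Z x) (real k)) \<le> expectation Z"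
      using intZ intminZ by (intro integral_mono) auto
    moreover obtain N where N: "\<bar>expectation (\<lambda>x. min (Y i x) (real k)) -
        expectation (\<lambda>x. min (Z x) (real k))\<bar> < e / 2" if "N \<le> i" for i
      using LIMSEQ_D[OF truncK, of "real k" "e / 2"] k(1) \<open>0 < e\<close> by auto
    ultimately have "norm (expectation (Y i) - expectation Z) < e" if "N \<le> i" for i
      using EYK[of "real k" i] N[OF that] k unfolding real_norm_def by linarith
    then show "\<exists>N. \<forall>i\<ge>N. norm (expectation (Y i) - expectation Z) < e"
      by blast
  qed
qed

text \<open>Exponential tilting of the Gaussian: the quadratic exponents add up to that of a centred
  normal law with variance \<open>1 / (1 + 2 * c)\<close>. The change of normalising constant, times
  \<open>exp c\<close>, is \<open>exp (log_mgf c)\<close>.\<close>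

lemma std_normal_density_times_exp:
  fixes c :: real
  assumes "- (1 / 2) < c"
  shows "std_normal_density x * exp (- c * (x\<^sup>2 - 1)) =
           exp (log_mgf c) * normal_density 0 (1 / sqrt (1 + 2 * c)) x"
proof -
  have *: "exp (ln (1 + 2 * c) / 2) = sqrt (1 + 2 * c)"
    using assms by (simp add: ln_sqrt[symmetric])
  have "exp (log_mgf c) = exp c / sqrt (1 + 2 * c)"
    unfolding log_mgf_def exp_diff * ..
  moreover have "normal_density 0 (1 / sqrt (1 + 2 * c)) x =
      sqrt (1 + 2 * c) / sqrt (2 * pi) * exp (- (x\<^sup>2 * (1 + 2 * c)) / 2)"
    using assms
    by (simp add: normal_density_def power_divide real_sqrt_divide)
  moreover have "exp c * exp (- (x\<^sup>2 * (1 + 2 * c)) / 2) = exp (- x\<^sup>2 / 2) * exp (- c * (x\<^sup>2 - 1))"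
    by (simp add: exp_add[symmetric] field_simps)
  ultimately show ?thesis
    using assms by (simp add: normal_density_def)
qed

lemma
  fixes c :: real
  assumes X: "distributed M lborel X std_normal_density" and c: "- (1 / 2) < c"
  shows integrable_exp_centred_chi_square: "integrable M (\<lambda>w. exp (- c * ((X w)\<^sup>2 - 1)))"
    and integral_exp_centred_chi_square: "(LINT w|M. exp (- c * ((X w)\<^sup>2 - 1))) = exp (log_mgf c)"
proof -
  have \<sigma>: "0 < 1 / sqrt (1 + 2 * c)"
    using c by simp
  show "integrable M (\<lambda>w. exp (- c * ((X w)\<^sup>2 - 1)))"
    using distributed_integrable[OF X, of "\<lambda>x. exp (- c * (x\<^sup>2 - 1))"] \<sigma>
    unfolding std_normal_density_times_exp[OF c] by simp
  show "(LINT w|M. exp (- c * ((X w)\<^sup>2 - 1))) = exp (log_mgf c)"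
    using distributed_integral[OF X, of "\<lambda>x. exp (- c * (x\<^sup>2 - 1))"] \<sigma>
    unfolding std_normal_density_times_exp[OF c] by simp
qed

lemma
  assumes X: "distributed M lborel X std_normal_density"
  shows integrable_centred_chi_square: "integrable M (\<lambda>w. (X w)\<^sup>2 - 1)"
    and integral_centred_chi_square: "(LINT w|M. (X w)\<^sup>2 - 1) = 0"
    and integrable_centred_chi_square_square: "integrable M (\<lambda>w. ((X w)\<^sup>2 - 1)\<^sup>2)"
    and integral_centred_chi_square_square: "(LINT w|M. ((X w)\<^sup>2 - 1)\<^sup>2) = 2"
proof -
  \<comment> \<open>The moments of order 0, 2 and 4 are 1, 1 and 3, so the variance is 3 - 2 +
    1.\<close>
  note m = std_normal_moment_even[of 0] std_normal_moment_even[of 1] std_normal_moment_even[of 2]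
  have "has_bochner_integral lborel (\<lambda>x. std_normal_density x * (x\<^sup>2 - 1)) 0"
    using has_bochner_integral_diff[OF m(2,1)] by (simp add: algebra_simps power2_eq_square fact_numeral)
  then show "integrable M (\<lambda>w. (X w)\<^sup>2 - 1)" "(LINT w|M. (X w)\<^sup>2 - 1) = 0"
    using distributed_integrable[OF X, of "\<lambda>x. x\<^sup>2 - 1"] distributed_integral[OF X, of "\<lambda>x. x\<^sup>2 - 1"]
    by (auto simp: has_bochner_integral_iff)
  have "has_bochner_integral lborel
      (\<lambda>x. std_normal_density x * x ^ (2 * 2) - 2 * (std_normal_density x * x ^ (2 * 1)) + std_normal_density x * x ^ (2 * 0))
      (3 - 2 * 1 + 1)"
    using m
    by (intro has_bochner_integral_add has_bochner_integral_diff has_bochner_integral_mult_right)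
      (simp_all add: fact_numeral)
  then have "has_bochner_integral lborel (\<lambda>x. std_normal_density x * (x\<^sup>2 - 1)\<^sup>2) 2"
    by (simp add: power2_eq_square power4_eq_xxxx algebra_simps)
  then show "integrable M (\<lambda>w. ((X w)\<^sup>2 - 1)\<^sup>2)" "(LINT w|M. ((X w)\<^sup>2 - 1)\<^sup>2) = 2"
    using distributed_integrable[OF X, of "\<lambda>x. (x\<^sup>2 - 1)\<^sup>2"] distributed_integral[OF X, of "\<lambda>x. (x\<^sup>2 - 1)\<^sup>2"]
    by (auto simp: has_bochner_integral_iff)
qed

subsection \<open>Exponential moments of the limit\<close>

text \<open>Independence and zero means make the summands orthogonal, so the cross terms drop
  out.\<close>

lemma (in prob_space)
  fixes X :: "nat \<Rightarrow> 'a \<Rightarrow> real"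
  assumes indep: "indep_vars (\<lambda>_. borel) X UNIV"
    and int: "\<And>n. integrable M (X n)" and zero: "\<And>n. expectation (X n) = 0"
    and int2: "\<And>n. integrable M (\<lambda>w. (X n w)\<^sup>2)"
  shows integrable_square_sum_indep: "integrable M (\<lambda>w. (\<Sum>n<N. X n w)\<^sup>2)"
    and expectation_square_sum_indep:
      "expectation (\<lambda>w. (\<Sum>n<N. X n w)\<^sup>2) = (\<Sum>n<N. expectation (\<lambda>w. (X n w)\<^sup>2))"
proof -
  have prod: "integrable M (\<lambda>w. X i w * X j w) \<and> expectation (\<lambda>w. X i w * X j w) = 0"
    if "i \<noteq> j" for i j
  proof -
    have "indep_vars (\<lambda>_. borel) X {i, j}"
      using indep by (rule indep_vars_subset) simp
    then show ?thesis
      using indep_vars_integrable[of "{i, j}" X] indep_vars_lebesgue_integral[of "{i, j}" X]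
        int zero that by simp
  qed
  have "integrable M (\<lambda>w. (\<Sum>n<N. X n w)\<^sup>2) \<and>
      expectation (\<lambda>w. (\<Sum>n<N. X n w)\<^sup>2) = (\<Sum>n<N. expectation (\<lambda>w. (X n w)\<^sup>2))" for N
  proof (induction N)
    case (Suc N)
    have eq: "(\<Sum>n<Suc N. X n w)\<^sup>2 = (\<Sum>n<N. X n w)\<^sup>2 + 2 * (\<Sum>n<N. X n w * X N w) + (X N w)\<^sup>2" for w
      by (simp add: power2_sum sum_distrib_right sum_distrib_left mult_ac)
    have "integrable M (\<lambda>w. X n w * X N w)" "expectation (\<lambda>w. X n w * X N w) = 0" if "n < N" for n
      using prod[of n N] that by simp_all
    then have "integrable M (\<lambda>w. \<Sum>n<N. X n w * X N w)" "expectation (\<lambda>w. \<Sum>n<N. X n w * X N w) = 0"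
      by (auto simp: Bochner_Integration.integral_sum)
    then show ?case
      unfolding eq using Suc int2 by simp
  qed simp
  then show "integrable M (\<lambda>w. (\<Sum>n<N. X n w)\<^sup>2)"
    and "expectation (\<lambda>w. (\<Sum>n<N. X n w)\<^sup>2) = (\<Sum>n<N. expectation (\<lambda>w. (X n w)\<^sup>2))"
    by simp_all
qed

section \<open>Partial sums of the chaos and their mean-square limit\<close>

locale gaussian_chaos = prob_space M for M :: "'w measure" +
  fixes lam :: "nat \<Rightarrow> real" and \<epsilon> :: "nat \<Rightarrow> 'w \<Rightarrow> real" and V :: "'w \<Rightarrow> real"
  assumes lam_dec: "decseq lam" and lam_pos: "\<And>n. 0 < lam n"
    and indep: "indep_vars (\<lambda>_. borel) \<epsilon> UNIV"
    and normal: "\<And>n. distributed M lborel (\<epsilon> n) std_normal_density"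
    and L2_sums_V: "L2_sums M (\<lambda>n w. lam n * ((\<epsilon> n w)\<^sup>2 - 1)) V"
begin

definition "X n w = lam n * ((\<epsilon> n w)\<^sup>2 - 1)"

lemma measurable_eps [measurable]: "\<epsilon> n \<in> borel_measurable M"
  using distributed_measurable[OF normal[of n]] by simp

lemma measurable_X [measurable]: "X n \<in> borel_measurable M"
  unfolding X_def by measurable

lemma measurable_V [measurable]: "V \<in> borel_measurable M"
  using L2_sums_V by (simp add: L2_sums_def L2_def)

lemma integrable_V_square: "integrable M (\<lambda>w. (V w)\<^sup>2)"
  using L2_sums_V by (simp add: L2_sums_def L2_def)

lemma L2_convergence: "(\<lambda>N. expectation (\<lambda>w. ((\<Sum>n<N. X n w) - V w)\<^sup>2)) \<longlonglongrightarrow> 0"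
  using L2_sums_V by (simp add: L2_sums_def X_def)

lemma indep_X: "indep_vars (\<lambda>_. borel) X UNIV"
  using indep_vars_compose2[OF indep, of "\<lambda>n x. lam n * (x\<^sup>2 - 1)" "\<lambda>_. borel"]
  by (simp add: X_def[abs_def])

lemma integrable_partial_sum_square: "integrable M (\<lambda>w. (\<Sum>n<N. X n w)\<^sup>2)"
  and expectation_partial_sum_square:
    "expectation (\<lambda>w. (\<Sum>n<N. X n w)\<^sup>2) = (\<Sum>n<N. 2 * (lam n)\<^sup>2)"
proof -
  have 1: "integrable M (X n)" "expectation (X n) = 0" for n
    using integrable_centred_chi_square[OF normal] integral_centred_chi_square[OF normal]
    by (simp_all add: X_def[abs_def])
  have 2: "integrable M (\<lambda>w. (X n w)\<^sup>2)" "expectation (\<lambda>w. (X n w)\<^sup>2) = 2 * (lam n)\<^sup>2" for n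
    using integrable_centred_chi_square_square[OF normal] integral_centred_chi_square_square[OF normal]
    by (simp_all add: X_def[abs_def] power_mult_distrib)
  show "integrable M (\<lambda>w. (\<Sum>n<N. X n w)\<^sup>2)"
    by (rule integrable_square_sum_indep[OF indep_X 1 2(1)])
  show "expectation (\<lambda>w. (\<Sum>n<N. X n w)\<^sup>2) = (\<Sum>n<N. 2 * (lam n)\<^sup>2)"
    unfolding expectation_square_sum_indep[OF indep_X 1 2(1)] 2(2) ..
qed

text \<open>The Bochner integral of a non-integrable function is 0, so \<open>L2_convergence\<close>
  has its intended meaning only together with this fact.\<close>

lemma integrable_remainder_square: "integrable M (\<lambda>w. ((\<Sum>n<N. X n w) - V w)\<^sup>2)"
proof (rule Bochner_Integration.integrable_bound)
  show "integrable M (\<lambda>w. 2 * (\<Sum>n<N. X n w)\<^sup>2 + 2 * (V w)\<^sup>2)"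
    using integrable_partial_sum_square integrable_V_square by simp
  have "(x - y)\<^sup>2 \<le> 2 * x\<^sup>2 + 2 * y\<^sup>2" for x y :: real
    using zero_le_power2[of "x + y"] by (simp add: power2_eq_square algebra_simps)
  then show "AE w in M. norm (((\<Sum>n<N. X n w) - V w)\<^sup>2) \<le> norm (2 * (\<Sum>n<N. X n w)\<^sup>2 + 2 * (V w)\<^sup>2)"
    by (intro AE_I2) simp
qed simp

text \<open>By orthogonality, twice the partial sum of the squares is the second moment of a partial
  sum of the chaos. This stays bounded because the remainders do and \<open>V\<close> is square
  integrable.\<close>

lemma summable_lam_square: "summable (\<lambda>n. (lam n)\<^sup>2)"
proof -
  obtain B where B: "\<And>N. norm (expectation (\<lambda>w. ((\<Sum>n<N. X n w) - V w)\<^sup>2)) \<le> B"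
    using Bseq_eq_bounded convergent_imp_Bseq[OF convergentI[OF L2_convergence]]
    by (auto simp: Bseq_def)
  show ?thesis
  proof (rule summableI_nonneg_bounded)
    fix N
    \<comment> \<open>The difference of the two sides is \<open>(x - 2 * y)\<^sup>2\<close>.\<close>
    have le: "x\<^sup>2 \<le> 2 * (x - y)\<^sup>2 + 2 * y\<^sup>2" for x y :: real
      using zero_le_power2[of "x - 2 * y"] by (simp add: power2_eq_square algebra_simps)
    have "2 * (\<Sum>n<N. (lam n)\<^sup>2) = expectation (\<lambda>w. (\<Sum>n<N. X n w)\<^sup>2)"
      unfolding expectation_partial_sum_square by (simp add: sum_distrib_left)
    also have "\<dots> \<le> expectation (\<lambda>w. 2 * ((\<Sum>n<N. X n w) - V w)\<^sup>2 + 2 * (V w)\<^sup>2)"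
      using integrable_partial_sum_square integrable_remainder_square integrable_V_square le
      by (intro integral_mono) auto
    also have "\<dots> \<le> 2 * B + 2 * expectation (\<lambda>w. (V w)\<^sup>2)"
      using B[of N] integrable_remainder_square integrable_V_square by simp
    finally show "(\<Sum>n<N. (lam n)\<^sup>2) \<le> B + expectation (\<lambda>w. (V w)\<^sup>2)"
      by simp
  qed simp
qed

text \<open>Mean-square convergence gives almost sure convergence along a subsequence. That suffices
  below, since the exponential moments of the partial sums converge along the full sequence.\<close>

lemma partial_sum_subsequence:
  obtains r :: "nat \<Rightarrow> nat" where "strict_mono r"
    and "AE w in M. (\<lambda>i. \<Sum>n<r i. X n w) \<longlonglongrightarrow> V w"
proof -
  obtain r :: "nat \<Rightarrow> nat" where r: "strict_mono r"
      "AE w in M. (\<lambda>i. ((\<Sum>n<r i. X n w) - V w)\<^sup>2) \<longlonglongrightarrow> 0"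
    using tendsto_L1_AE_subseq[of M "\<lambda>N w. ((\<Sum>n<N. X n w) - V w)\<^sup>2"]
      integrable_remainder_square L2_convergence by auto
  have "AE w in M. (\<lambda>i. \<Sum>n<r i. X n w) \<longlonglongrightarrow> V w"
    using r(2)
  proof eventually_elim
    case (elim w)
    have "(\<lambda>i. sqrt (((\<Sum>n<r i. X n w) - V w)\<^sup>2)) \<longlonglongrightarrow> sqrt 0"
      by (intro tendsto_real_sqrt elim)
    then show ?case
      by (simp add: tendsto_rabs_zero_iff LIM_zero_iff)
  qed
  then show ?thesis
    using r(1) that by blast
qed

text \<open>Independence factorises the exponential of the sum; each factor is a chi-square integral
  with parameter \<open>lam n * s\<close>.\<close>

lemma
  assumes "- 1 / (2 * lam 0) < s"
  shows integrable_exp_partial_sum: "integrable M (\<lambda>w. exp (- s * (\<Sum>n<N. X n w)))"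
    and expectation_exp_partial_sum:
      "expectation (\<lambda>w. exp (- s * (\<Sum>n<N. X n w))) = exp (\<Sum>n<N. log_mgf (lam n * s))"
proof -
  have eq: "exp (- s * (\<Sum>n<N. X n w)) = (\<Prod>n<N. exp (- s * X n w))" for w
    by (simp add: sum_distrib_left exp_sum)
  have X: "- s * X n w = - (lam n * s) * ((\<epsilon> n w)\<^sup>2 - 1)" for n w
    by (simp add: X_def)
  have gt: "- (1 / 2) < lam n * s" for n
    using scaled_gt[OF lam_dec lam_pos summable_lam_square assms] .
  have int: "integrable M (\<lambda>w. exp (- s * X n w))"
    and exp: "expectation (\<lambda>w. exp (- s * X n w)) = exp (log_mgf (lam n * s))" for n
    unfolding X using integrable_exp_centred_chi_square[OF normal gt]
      integral_exp_centred_chi_square[OF normal gt] by simp_all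
  have "indep_vars (\<lambda>_. borel) (\<lambda>n w. exp (- s * X n w)) UNIV"
    using indep_vars_compose2[OF indep_X, of "\<lambda>_ x. exp (- s * x)" "\<lambda>_. borel"] by simp
  then have "indep_vars (\<lambda>_. borel) (\<lambda>n w. exp (- s * X n w)) {..<N}"
    by (rule indep_vars_subset) simp
  note prod = indep_vars_integrable[OF _ this int] indep_vars_lebesgue_integral[OF _ this int]
  show "integrable M (\<lambda>w. exp (- s * (\<Sum>n<N. X n w)))"
    unfolding eq using prod(1) by simp
  show "expectation (\<lambda>w. exp (- s * (\<Sum>n<N. X n w))) = exp (\<Sum>n<N. log_mgf (lam n * s))"
    unfolding eq using prod(2) by (simp only: finite_lessThan exp exp_sum)
qed

lemma
  assumes s: "- 1 / (2 * lam 0) < s"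
  shows integrable_exp_V: "integrable M (\<lambda>w. exp (- s * V w))"
    and expectation_exp_V: "expectation (\<lambda>w. exp (- s * V w)) = exp (\<Sum>n. log_mgf (lam n * s))"
proof -
  obtain r :: "nat \<Rightarrow> nat" where r: "strict_mono r"
      "AE w in M. (\<lambda>i. \<Sum>n<r i. X n w) \<longlonglongrightarrow> V w"
    by (rule partial_sum_subsequence)
  \<comment> \<open>The domain is an open half-line. For \<open>s \<ge> 0\<close> the choice 2
    works; for negative \<open>s\<close> any number strictly between 1 and the quotient of the
    boundary point by \<open>s\<close> does.\<close>
  obtain p where p: "1 < p" "- 1 / (2 * lam 0) < p * s"
  proof (cases "0 \<le> s")
    case True
    moreover have "- 1 / (2 * lam 0) < 0"
      using lam_pos[of 0] by simp
    ultimately have "- 1 / (2 * lam 0) < 2 * s"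
      by linarith
    then show ?thesis
      by (rule that[rotated]) simp
  next
    case False
    then have "1 < (- 1 / (2 * lam 0)) / s"
      using s by (subst neg_less_divide_eq) auto
    then obtain q where q: "1 < q" "q < (- 1 / (2 * lam 0)) / s"
      using dense by blast
    have "- 1 / (2 * lam 0) < q * s"
      using q(2) False by (intro neg_less_divide_eq[THEN iffD1]) auto
    then show ?thesis
      using that q(1) by blast
  qed
  define Y where "Y i w = exp (- s * (\<Sum>n<r i. X n w))" for i w
  have Yp: "Y i w powr p = exp (- (p * s) * (\<Sum>n<r i. X n w))" for i w
    by (simp add: Y_def powr_def)
  have Y [measurable]: "Y i \<in> borel_measurable M" for i
    unfolding Y_def by measurable
  \<comment> \<open>The \<open>p\<close>-th power of \<open>Y i\<close> is the same exponential at
    \<open>p * s\<close>, whose expectation is known exactly. As \<open>log_mgf\<close> is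
    nonnegative here, finite sums lie below the full sum, uniformly in \<open>i\<close>.\<close>
  have bound: "expectation (\<lambda>w. Y i w powr p) \<le> exp (\<Sum>n. log_mgf (lam n * (p * s)))" for i
    unfolding Yp expectation_exp_partial_sum[OF p(2)]
    using summable_log_mgf[OF lam_dec lam_pos summable_lam_square p(2)]
      log_mgf_nonneg[OF scaled_gt[OF lam_dec lam_pos summable_lam_square p(2)]]
    by (simp add: sum_le_suminf)
  have int: "integrable M (\<lambda>w. Y i w powr p)" for i
    unfolding Yp by (rule integrable_exp_partial_sum[OF p(2)])
  have lim: "AE w in M. (\<lambda>i. Y i w) \<longlonglongrightarrow> exp (- s * V w)"
    using r(2) unfolding Y_def by eventually_elim (intro tendsto_intros)
  note conv = tendsto_expectation_bounded_powr[OF Y _ _ _ lim p(1) int bound]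
  show "integrable M (\<lambda>w. exp (- s * V w))"
    by (rule conv(1)) (simp_all add: Y_def)
  have lim_V: "(\<lambda>i. expectation (Y i)) \<longlonglongrightarrow> expectation (\<lambda>w. exp (- s * V w))"
    by (rule conv(2)) (simp_all add: Y_def)
  have "(\<lambda>N. exp (\<Sum>n<N. log_mgf (lam n * s))) \<longlonglongrightarrow> exp (\<Sum>n. log_mgf (lam n * s))"
    by (intro tendsto_exp summable_LIMSEQ summable_log_mgf[OF lam_dec lam_pos summable_lam_square s])
  moreover have "expectation (Y i) = exp (\<Sum>n<r i. log_mgf (lam n * s))" for i
    unfolding Y_def by (rule expectation_exp_partial_sum[OF s])
  ultimately have "(\<lambda>i. expectation (Y i)) \<longlonglongrightarrow> exp (\<Sum>n. log_mgf (lam n * s))"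
    using LIMSEQ_subseq_LIMSEQ[OF _ r(1)] by (force simp: comp_def)
  with lim_V show "expectation (\<lambda>w. exp (- s * V w)) = exp (\<Sum>n. log_mgf (lam n * s))"
    by (rule LIMSEQ_unique)
qed

text \<open>The modulus of the integrand is \<open>exp (- Re s * V w)\<close>.\<close>

lemma integrable_cexp_V:
  assumes "- 1 / (2 * lam 0) < Re s"
  shows "integrable M (\<lambda>w. exp (- s * complex_of_real (V w)))"
  using integrable_exp_V[OF assms] by (rule Bochner_Integration.integrable_bound) auto

lemma ln_laplace_transform_V:
  assumes "- 1 / (2 * lam 0) < s"
  shows "ln (laplace_transform M V (complex_of_real s)) = complex_of_real (\<Sum>n. log_mgf (lam n * s))"
proof -
  have "laplace_transform M V (complex_of_real s) = (CLINT w|M. complex_of_real (exp (- s * V w)))"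
    unfolding laplace_transform_def
    by (intro Bochner_Integration.integral_cong) (simp_all add: exp_of_real[symmetric])
  also have "\<dots> = complex_of_real (exp (\<Sum>n. log_mgf (lam n * s)))"
    unfolding integral_complex_of_real expectation_exp_V[OF assms] ..
  finally show ?thesis
    by (simp add: Ln_of_real)
qed

lemma char_V: "char (distr M borel V) z = laplace_transform M V (- \<i> * complex_of_real z)"
  by (simp add: char_def laplace_transform_def integral_distr mult.assoc)

end

subsection \<open>The representations\<close>

theorem theorem3p1:
  fixes a :: real and lam :: "nat \<Rightarrow> real"
    and M :: "'w measure" and \<epsilon> :: "nat \<Rightarrow> 'w \<Rightarrow> real" and V :: "'w \<Rightarrow> real"
  assumes "0 < a" and "a < 1 / 2"
    and "riesz_eigenvalues a lam"
    and "prob_space M"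
    and "prob_space.indep_vars M (\<lambda>_. borel) \<epsilon> UNIV"
    and "\<forall>n. distributed M lborel (\<epsilon> n) std_normal_density"
    and "L2_sums M (\<lambda>n w. lam n * ((\<epsilon> n w)\<^sup>2 - 1)) V"
  shows "(\<forall>s :: complex. Re s > - 1 / (2 * lam 0) \<longrightarrow>
            integrable M (\<lambda>w. exp (- s * complex_of_real (V w)))) \<and>
    (\<forall>z :: real. char (distr M borel V) z = laplace_transform M V (- \<i> * complex_of_real z)) \<and>
    (\<forall>s :: real. s > - 1 / (2 * lam 0) \<longrightarrow>
      \<comment> \<open>(i)\<close>
      ((\<forall>n. summable (\<lambda>k. 1 / (2 * real (k + 2) - 1) *
                (lam n * s / (1 + lam n * s)) ^ (2 * (k + 2) - 1))) \<and>
       summable (\<lambda>n. (lam n * s)\<^sup>2 / (1 + lam n * s) -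
          (\<Sum>k. 1 / (2 * real (k + 2) - 1) * (lam n * s / (1 + lam n * s)) ^ (2 * (k + 2) - 1))) \<and>
       ln (laplace_transform M V (complex_of_real s)) =
         complex_of_real (\<Sum>n. (lam n * s)\<^sup>2 / (1 + lam n * s) -
          (\<Sum>k. 1 / (2 * real (k + 2) - 1) * (lam n * s / (1 + lam n * s)) ^ (2 * (k + 2) - 1)))) \<and>
      \<comment> \<open>(ii)\<close>
      ((\<forall>n. summable (\<lambda>k. 1 / (2 ^ Suc k * (1 + (1 + 2 * lam n * s) powr (1 / 2 ^ Suc k))))) \<and>
       summable (\<lambda>n. lam n * s * ln (1 + 2 * lam n * s) *
          (\<Sum>k. 1 / (2 ^ Suc k * (1 + (1 + 2 * lam n * s) powr (1 / 2 ^ Suc k))))) \<and>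
       ln (laplace_transform M V (complex_of_real s)) =
         complex_of_real (\<Sum>n. lam n * s * ln (1 + 2 * lam n * s) *
          (\<Sum>k. 1 / (2 ^ Suc k * (1 + (1 + 2 * lam n * s) powr (1 / 2 ^ Suc k)))))) \<and>
      \<comment> \<open>(iii)\<close>
      ((\<forall>n. summable (\<lambda>k. 2 ^ k * ((1 + 2 * lam n * s) powr (1 / 2 ^ Suc k) - 1)\<^sup>2)) \<and>
       summable (\<lambda>n. \<Sum>k. 2 ^ k * ((1 + 2 * lam n * s) powr (1 / 2 ^ Suc k) - 1)\<^sup>2) \<and>
       ln (laplace_transform M V (complex_of_real s)) =
         complex_of_real (1 / 2 *
          (\<Sum>n. \<Sum>k. 2 ^ k * ((1 + 2 * lam n * s) powr (1 / 2 ^ Suc k) - 1)\<^sup>2))) \<and>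
      \<comment> \<open>(iv)\<close>
      (summable (\<lambda>n. 2 * (lam n)\<^sup>2 * s / (2 * lam n * s + 1)) \<and>
       interval_lebesgue_integrable lborel (ereal 0) (ereal s)
         (\<lambda>u. \<Sum>n. 2 * (lam n)\<^sup>2 * u / (2 * lam n * u + 1)) \<and>
       ln (laplace_transform M V (complex_of_real s)) =
         complex_of_real (LBINT u=ereal 0..ereal s.
           (\<Sum>n. 2 * (lam n)\<^sup>2 * u / (2 * lam n * u + 1)))))"
proof -
  have lam: "decseq lam" "\<And>n. 0 < lam n"
    using assms(3) by (auto simp: riesz_eigenvalues_def)
  interpret gaussian_chaos M lam \<epsilon> V
    using assms(4-7) lam by (simp add: gaussian_chaos_def gaussian_chaos_axioms_def)
  have gt: "- (1 / 2) < lam n * s" if "- 1 / (2 * lam 0) < s" for n s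
    using scaled_gt[OF lam summable_lam_square that] .
  show ?thesis
  \<comment> \<open>Cases 3-5, 6-8 and 9-11 give, for (i) to (iii) in turn, inner summability, outer
    summability and the identity. Cases 12-14 give summability, integrability and the identity for
    (iv).\<close>
  proof (intro conjI allI impI, goal_cases)
    case (1 s)
    then show ?case
      by (rule integrable_cexp_V)
  next
    case (2 z)
    show ?case
      by (rule char_V)
  next
    case (3 s n)
    show ?case
      by (rule sums_summable[OF log_mgf_artanh_series[OF gt[OF 3]]])
  next
    case (4 s)
    then show ?case
      \<comment> \<open>Once the inner series is replaced by its sum,
        \<open>x\<^sup>2 / (1 + x)\<close> cancels and \<open>log_mgf\<close> remains.\<close>
      using summable_log_mgf[OF lam summable_lam_square 4]
      by (simp only: sums_unique[OF log_mgf_artanh_series[OF gt[OF 4]], symmetric] diff_diff_eq2 add_diff_cancel_left')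
  next
    case (5 s)
    then show ?case
      by (simp only: sums_unique[OF log_mgf_artanh_series[OF gt[OF 5]], symmetric] diff_diff_eq2 add_diff_cancel_left'
          ln_laplace_transform_V[OF 5])
  next
    case (6 s n)
    then show ?case
      using gt[OF 6, of n] by (intro summable_inverse_ln_series) simp
  next
    case (7 s)
    then show ?case
      using summable_log_mgf[OF lam summable_lam_square 7]
      by (simp only: log_mgf_inverse_ln_series[OF gt[OF 7], unfolded mult.assoc[symmetric]])
  next
    case (8 s)
    then show ?case
      by (simp only: log_mgf_inverse_ln_series[OF gt[OF 8], unfolded mult.assoc[symmetric]]
          ln_laplace_transform_V[OF 8])
  next
    case (9 s n)
    show ?case
      using sums_summable[OF log_mgf_square_series[OF gt[OF 9]]] by (simp only: mult.assoc)
  next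
    case (10 s)
    then show ?case
      using summable_mult[OF summable_log_mgf[OF lam summable_lam_square 10], of 2]
      by (simp only: sums_unique[OF log_mgf_square_series[OF gt[OF 10]], symmetric] mult.assoc)
  next
    case (11 s)
    then show ?case
      \<comment> \<open>The inner series sums to twice \<open>log_mgf\<close>, which the prefactor
        1/2 undoes.\<close>
      using suminf_mult[OF summable_log_mgf[OF lam summable_lam_square 11], of 2]
      by (simp only: sums_unique[OF log_mgf_square_series[OF gt[OF 11]], symmetric] mult.assoc
          ln_laplace_transform_V[OF 11]) simp
  next
    case (12 s)
    then show ?case
      by (rule log_mgf_integral_representation(1)[OF lam summable_lam_square])
  next
    case (13 s)
    then show ?case
      by (rule log_mgf_integral_representation(2)[OF lam summable_lam_square])
  next
    case (14 s)
    then show ?case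
      by (simp add: ln_laplace_transform_V log_mgf_integral_representation(3)[OF lam summable_lam_square])
  qed
qed

end
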